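(* Let $G$ be a bipartite graph. Then $G$ is $\chi$-unfrozen if and only if $G$ possesses no $P_3$ as an induced subgraph.
   Context: Graphs are finite, undirected, simple, without loops. $G$ is bipartite if $V(G)=V_1\cup V_2$ with $V_1\cap V_2=\emptyset$ and every edge has one endpoint in $V_1$ and one in $V_2$. $P_3$ is the path with $3$ vertices (and two edges). $\chi(G)$ is the chromatic number, i.e., the minimum number of colors needed to color the vertices of $G$ so that no two adjacent vertices have the same color. A nonedge of $G$ is a pair $e=\{u,v\}$ of distinct vertices of $G$ with $e\notin E(G)$; $G+e$ is the graph obtained from $G$ by adding $e$ as an edge. $G$ is $\chi$-unfrozen if $\chi(G+e)=\chi(G)$ for every nonedge $e$ of $G$.
   Formalization: The formal statement additionally assumes that G has at least one edge or at most one vertex; for an edgeless G with two or more vertices the claim fails, since G has no induced P_3 but adding any edge raises the chromatic number from 1 to 2. *)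

theory Defs
  imports Main
begin

record 'a graph =
  verts :: "'a set"
  edges :: "'a set set"

definition simple_graph :: "'a graph \<Rightarrow> bool" where
  "simple_graph G \<longleftrightarrow> finite (verts G) \<and> (\<forall>e \<in> edges G. e \<subseteq> verts G \<and> card e = 2)"

definition bipartite :: "'a graph \<Rightarrow> bool" where
  "bipartite G \<longleftrightarrow>
    (\<exists>V1 V2. verts G = V1 \<union> V2 \<and> V1 \<inter> V2 = {} \<and>
      (\<forall>e \<in> edges G. \<exists>u \<in> V1. \<exists>v \<in> V2. e = {u, v}))"

definition colorable :: "'a graph \<Rightarrow> nat \<Rightarrow> bool" where
  "colorable G k \<longleftrightarrow>
    (\<exists>c :: 'a \<Rightarrow> nat. (\<forall>v \<in> verts G. c v < k) \<and>
      (\<forall>u \<in> verts G. \<forall>v \<in> verts G. {u, v} \<in> edges G \<longrightarrow> c u \<noteq> c v))"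

(* A finite simple graph is colorable with card (verts G) colors, so the minimum exists. *)
definition chromatic_number :: "'a graph \<Rightarrow> nat" where
  "chromatic_number G = (LEAST k. colorable G k)"

definition nonedges :: "'a graph \<Rightarrow> 'a set set" where
  "nonedges G = {{u, v} | u v. u \<in> verts G \<and> v \<in> verts G \<and> u \<noteq> v \<and> {u, v} \<notin> edges G}"

definition add_edge :: "'a graph \<Rightarrow> 'a set \<Rightarrow> 'a graph" where
  "add_edge G e = G\<lparr>edges := insert e (edges G)\<rparr>"

definition chi_unfrozen :: "'a graph \<Rightarrow> bool" where
  "chi_unfrozen G \<longleftrightarrow>
    (\<forall>e \<in> nonedges G. chromatic_number (add_edge G e) = chromatic_number G)"

definition induced_subgraph :: "'a graph \<Rightarrow> 'a set \<Rightarrow> 'a graph" where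
  "induced_subgraph G W = \<lparr>verts = W, edges = {e \<in> edges G. e \<subseteq> W}\<rparr>"

definition graph_iso :: "'a graph \<Rightarrow> 'b graph \<Rightarrow> bool" where
  "graph_iso G H \<longleftrightarrow>
    (\<exists>f. bij_betw f (verts G) (verts H) \<and>
      (\<forall>u \<in> verts G. \<forall>v \<in> verts G. {u, v} \<in> edges G \<longleftrightarrow> {f u, f v} \<in> edges H))"

definition has_induced_subgraph :: "'a graph \<Rightarrow> 'b graph \<Rightarrow> bool" where
  "has_induced_subgraph G F \<longleftrightarrow>
    (\<exists>W \<subseteq> verts G. graph_iso F (induced_subgraph G W))"

(* The path with n vertices, not n edges. *)
definition path_graph :: "nat \<Rightarrow> nat graph" where
  "path_graph n = \<lparr>verts = {..<n}, edges = {{i, Suc i} | i. Suc i < n}\<rparr>"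

(* An edgeless graph with at least two vertices is bipartite and has no induced path on three
   vertices, but any added edge raises its chromatic number from 1 to 2. *)
lemma edgeless_counterexample:
  fixes G :: "'a graph"
  assumes "simple_graph G" "edges G = {}" "2 \<le> card (verts G)"
  shows "bipartite G" "\<not> has_induced_subgraph G (path_graph 3)" "\<not> chi_unfrozen G"
proof -
  show "bipartite G"
    using assms(2) unfolding bipartite_def by auto
  show "\<not> has_induced_subgraph G (path_graph 3)"
  proof
    assume "has_induced_subgraph G (path_graph 3)"
    then have "\<forall>i<3. \<forall>j<3. {i, j} \<notin> edges (path_graph 3)"
      using assms(2)
      by (auto simp: has_induced_subgraph_def graph_iso_def induced_subgraph_def path_graph_def)
    then have "{0, Suc 0} \<notin> edges (path_graph 3)"
      by (metis numeral_3_eq_3 zero_less_Suc Suc_less_eq)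
    then show False
      by (auto simp: path_graph_def)
  qed
  obtain u where u: "u \<in> verts G"
    using assms(3) by fastforce
  obtain v where v: "v \<in> verts G" "u \<noteq> v"
  proof -
    have "\<not> verts G \<subseteq> {u}"
      using assms(3) card_mono[of "{u}" "verts G"] by auto
    with that show ?thesis by blast
  qed
  have "colorable G 1"
    using assms(2) unfolding colorable_def by (intro exI[of _ "\<lambda>_. 0"]) auto
  then have "chromatic_number G \<le> 1"
    unfolding chromatic_number_def by (rule Least_le)
  moreover have "2 \<le> chromatic_number (add_edge G {u, v})"
  proof -
    let ?H = "add_edge G {u, v}"
    have ge: "2 \<le> k" if H: "colorable ?H k" for k
    proof -
      obtain c :: "'a \<Rightarrow> nat" where "c u < k" "c v < k" "c u \<noteq> c v"
        using H u v by (auto simp: colorable_def add_edge_def)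
      then show ?thesis by linarith
    qed
    have "colorable ?H 2"
      using assms(2) v unfolding colorable_def add_edge_def
      by (intro exI[of _ "\<lambda>x. if x = u then 0 else 1"]) (auto simp: doubleton_eq_iff)
    then have "colorable ?H (chromatic_number ?H)"
      unfolding chromatic_number_def by (rule LeastI)
    then show ?thesis by (rule ge)
  qed
  moreover have "{u, v} \<in> nonedges G"
    using u v assms(2) by (auto simp: nonedges_def)
  ultimately show "\<not> chi_unfrozen G"
    unfolding chi_unfrozen_def by force
qed

end

theory Submission imports Defs begin

text \<open>A bipartite graph with an edge has chromatic number 2. If \<open>x - y - z\<close> is an induced path, then
  adding \<open>{x, z}\<close> creates a triangle and so raises the chromatic number. If there is no induced
  path on three vertices, then no vertex has two neighbours (they would lie in the same part), so
  swapping the colours on \<open>v\<close> and its neighbours keeps a 2-colouring proper; this makes room for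
  any new edge \<open>{u, v}\<close> whose ends had the same colour.\<close>

lemma path_graph_3: "path_graph 3 = \<lparr>verts = {0, 1, 2}, edges = {{0, 1}, {1, 2}}\<rparr>"
proof -
  have "{..<3::nat} = {0, 1, 2}" by auto
  moreover have "{{i, Suc i} |i. Suc i < 3} = {{0, 1}, {1, 2}}"
  proof -
    have "Suc i < 3 \<longleftrightarrow> i = 0 \<or> i = 1" for i by auto
    then show ?thesis by (auto simp: numeral_2_eq_2)
  qed
  ultimately show ?thesis by (simp add: path_graph_def)
qed

lemma simple_graph_edgeD:
  assumes "simple_graph G" "{u, v} \<in> edges G"
  shows "u \<in> verts G" "v \<in> verts G" "u \<noteq> v"
  using assms by (auto simp: simple_graph_def)

text \<open>Trades the isomorphism for three named vertices forming a path \<open>x\<close>,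
  \<open>y\<close>, \<open>z\<close>. Simplicity makes \<open>y\<close> differ from both ends, so
  \<open>{x, y, z}\<close> really has three elements.\<close>

lemma has_induced_P3_iff:
  assumes G: "simple_graph G"
  shows "has_induced_subgraph G (path_graph 3) \<longleftrightarrow>
    (\<exists>x y z. x \<noteq> z \<and> {x, y} \<in> edges G \<and> {y, z} \<in> edges G \<and> {x, z} \<notin> edges G)"
    (is "?L \<longleftrightarrow> ?R")
proof
  assume ?L
  then obtain W f where "bij_betw f (verts (path_graph 3)) (verts (induced_subgraph G W))"
    and "\<forall>i\<in>verts (path_graph 3). \<forall>j\<in>verts (path_graph 3).
      {i, j} \<in> edges (path_graph 3) \<longleftrightarrow> {f i, f j} \<in> edges (induced_subgraph G W)"
    unfolding has_induced_subgraph_def graph_iso_def by blast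
  then have f: "bij_betw f {0, 1, 2} W"
    and iso: "\<forall>i\<in>{0, 1, 2}. \<forall>j\<in>{0, 1, 2}.
      {i, j} \<in> {{0, 1}, {1, 2}} \<longleftrightarrow> {f i, f j} \<in> {e \<in> edges G. e \<subseteq> W}"
    by (simp_all only: path_graph_3 induced_subgraph_def graph.simps)
  \<comment> \<open>The isomorphism only sees edges inside \<open>W\<close>; with both ends in
    \<open>W\<close>, a missing edge of the induced subgraph is missing in \<open>G\<close>
    too.\<close>
  have W: "f 0 \<in> W" "f 2 \<in> W"
    using f by (auto simp: bij_betw_def)
  have "f 0 \<noteq> f 2"
    using f by (auto simp: bij_betw_def)
  moreover have "{f 0, f 1} \<in> edges G" using iso by simp
  moreover have "{f 1, f 2} \<in> edges G" using iso by simp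
  moreover have "{f 0, f 2} \<notin> edges G"
    using iso W by (auto simp: doubleton_eq_iff)
  ultimately show ?R by blast
next
  assume ?R
  then obtain x y z where xz: "x \<noteq> z" "{x, z} \<notin> edges G"
    and e: "{x, y} \<in> edges G" "{y, z} \<in> edges G" by blast
  note d = simple_graph_edgeD[OF G e(1)] simple_graph_edgeD[OF G e(2)]
  have e': "{y, x} \<in> edges G" "{z, y} \<in> edges G" "{z, x} \<notin> edges G"
    using e xz(2) by (simp_all add: insert_commute)
  \<comment> \<open>The isomorphism condition also ranges over equal pairs, which collapse to
    singletons.\<close>
  have loop: "{w} \<notin> edges G" for w
    using simple_graph_edgeD(3)[OF G, of w w] by auto
  let ?f = "\<lambda>i::nat. if i = 0 then x else if i = 1 then y else z"
  have "graph_iso (path_graph 3) (induced_subgraph G {x, y, z})"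
    unfolding graph_iso_def
  proof (intro exI conjI)
    show "bij_betw ?f (verts (path_graph 3)) (verts (induced_subgraph G {x, y, z}))"
      using xz d by (auto simp: path_graph_3 induced_subgraph_def bij_betw_def)
    show "\<forall>u\<in>verts (path_graph 3). \<forall>v\<in>verts (path_graph 3).
      ({u, v} \<in> edges (path_graph 3)) = ({?f u, ?f v} \<in> edges (induced_subgraph G {x, y, z}))"
      using xz e e' loop by (simp add: path_graph_3 induced_subgraph_def doubleton_eq_iff)
  qed
  moreover have "{x, y, z} \<subseteq> verts G"
    using d by simp
  ultimately show ?L
    unfolding has_induced_subgraph_def by (intro exI[of _ "{x, y, z}"] conjI)
qed

text \<open>The indicator of one part is the colouring. It is total on the type, so later uses carry
  no membership side conditions.\<close>

lemma bipartite_two_coloring: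
  assumes "bipartite G"
  obtains c :: "'a \<Rightarrow> nat" where "\<And>v. c v < 2" "\<And>u v. {u, v} \<in> edges G \<Longrightarrow> c u \<noteq> c v"
proof -
  obtain V1 V2 where V: "V1 \<inter> V2 = {}" "\<forall>e\<in>edges G. \<exists>u\<in>V1. \<exists>v\<in>V2. e = {u, v}"
    using assms unfolding bipartite_def by (elim exE conjE)
  let ?c = "\<lambda>v. if v \<in> V1 then 0 else 1 :: nat"
  have "?c u \<noteq> ?c v" if e: "{u, v} \<in> edges G" for u v
  proof -
    obtain a b where "a \<in> V1" "b \<in> V2" "{u, v} = {a, b}"
      using bspec[OF V(2) e] by (elim bexE)
    with V(1) show ?thesis by (auto simp: doubleton_eq_iff)
  qed
  with that[of ?c] show thesis by simp
qed

lemma chromatic_number_le: "colorable G k \<Longrightarrow> chromatic_number G \<le> k"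
  unfolding chromatic_number_def by (rule Least_le)

lemma colorable_chromatic_number: "colorable G k \<Longrightarrow> colorable G (chromatic_number G)"
  unfolding chromatic_number_def by (rule LeastI)

lemma chromatic_number_eq_2:
  assumes "colorable G 2" "{u, v} \<in> edges G" "u \<in> verts G" "v \<in> verts G"
  shows "chromatic_number G = 2"
proof -
  obtain c where "c u < chromatic_number G" "c v < chromatic_number G" "c u \<noteq> c v"
    using colorable_chromatic_number[OF assms(1)] assms(2-4) unfolding colorable_def by blast
  then show ?thesis
    using chromatic_number_le[OF assms(1)] by linarith
qed

text \<open>The arbitrary \<open>k\<close> only guarantees that the \<open>LEAST\<close> in the
  chromatic number is attained; an optimal colouring then gives the triangle three distinct
  colours.\<close>

lemma chromatic_number_triangle:
  assumes "colorable G k" "x \<in> verts G" "y \<in> verts G" "z \<in> verts G"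
    and "{x, y} \<in> edges G" "{y, z} \<in> edges G" "{x, z} \<in> edges G"
  shows "3 \<le> chromatic_number G"
proof -
  obtain c where "c x < chromatic_number G" "c y < chromatic_number G" "c z < chromatic_number G"
    "c x \<noteq> c y" "c y \<noteq> c z" "c x \<noteq> c z"
    using colorable_chromatic_number[OF assms(1)] assms(2-7) unfolding colorable_def by blast
  then show ?thesis by linarith
qed

text \<open>Giving \<open>x\<close> the fresh colour \<open>k\<close> resolves any conflict at the
  new edge. This supplies the colourability that the triangle bound asks for.\<close>

lemma colorable_add_edge_Suc:
  assumes G: "simple_graph G" and "colorable G k" and "x \<noteq> z"
  shows "colorable (add_edge G {x, z}) (Suc k)"
proof -
  obtain c where c: "\<And>v. v \<in> verts G \<Longrightarrow> c v < k"
    "\<And>u v. {u, v} \<in> edges G \<Longrightarrow> c u \<noteq> c v"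
    using assms(2) simple_graph_edgeD[OF G] unfolding colorable_def by metis
  have "(c(x := k)) u \<noteq> (c(x := k)) v"
    if "u \<in> verts G" "v \<in> verts G" "{u, v} \<in> insert {x, z} (edges G)" for u v
    using that c(1)[of u] c(1)[of v] c(2)[of u v] \<open>x \<noteq> z\<close>
    by (auto simp: doubleton_eq_iff)
  moreover have "(c(x := k)) v < Suc k" if "v \<in> verts G" for v
    using c(1)[OF that] by auto
  ultimately show ?thesis
    unfolding colorable_def add_edge_def by (intro exI[of _ "c(x := k)"]) simp
qed

lemma colorable_add_edge_matching:
  assumes G: "bipartite G"
    and matching: "\<And>x y z. {x, y} \<in> edges G \<Longrightarrow> {y, z} \<in> edges G \<Longrightarrow> x = z"
    and uv: "u \<noteq> v" "{u, v} \<notin> edges G"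
  shows "colorable (add_edge G {u, v}) 2"
proof -
  obtain c :: "'a \<Rightarrow> nat" where c: "\<And>w. c w < 2" "\<And>a b. {a, b} \<in> edges G \<Longrightarrow> c a \<noteq> c b"
    using bipartite_two_coloring[OF G] by blast
  \<comment> \<open>Under \<open>matching\<close> this is the whole component of \<open>v\<close>,
    or empty if \<open>c\<close> already separates \<open>u\<close> from \<open>v\<close>.\<close>
  define S where "S = (if c u = c v then {w. w = v \<or> {v, w} \<in> edges G} else {})"
  define d where "d = (\<lambda>w. if w \<in> S then 1 - c w else c w)"
  \<comment> \<open>If \<open>a\<close> is a neighbour of \<open>v\<close>, then
    \<open>matching\<close> forces \<open>b = v\<close>; if \<open>a = v\<close>, then
    \<open>b\<close> is a neighbour.\<close>
  have closed: "b \<in> S" if "a \<in> S" "{a, b} \<in> edges G" for a b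
    using that matching[of v a b] by (auto simp: S_def split: if_splits)
  have d2: "d w < 2" for w
    using c(1)[of w] by (auto simp: d_def)
  have "d a \<noteq> d b" if e: "{a, b} \<in> edges G" for a b
  proof -
    \<comment> \<open>Both ends of an edge are thus flipped or both kept; since colours are 0 or 1,
      \<open>1 - c w\<close> is a true swap despite truncated subtraction.\<close>
    have "a \<in> S \<longleftrightarrow> b \<in> S"
      using closed e by (metis insert_commute)
    then show ?thesis
      using c(1)[of a] c(1)[of b] c(2)[OF e] by (auto simp: d_def)
  qed
  moreover have "d u \<noteq> d v"
  proof -
    have "u \<notin> S" using uv by (auto simp: S_def insert_commute)
    then show ?thesis
      using c(1)[of v] by (cases "c v = 0") (auto simp: d_def S_def)
  qed
  ultimately have "d a \<noteq> d b" if "{a, b} \<in> insert {u, v} (edges G)" for a b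
    using that by (auto simp: doubleton_eq_iff)
  with d2 show ?thesis
    unfolding colorable_def add_edge_def by (intro exI[of _ d]) simp
qed

text \<open>The third hypothesis rules out exactly the edgeless graphs on two or more vertices,
  where the equivalence fails by \<open>edgeless_counterexample\<close>.\<close>

theorem theorem12:
  fixes G :: "'a graph"
  assumes "simple_graph G"
    and "bipartite G"
    and "edges G \<noteq> {} \<or> card (verts G) \<le> 1"
  shows "chi_unfrozen G \<longleftrightarrow> \<not> has_induced_subgraph G (path_graph 3)"
proof -
  note edgeD = simple_graph_edgeD[OF assms(1)]
  obtain c :: "'a \<Rightarrow> nat" where c: "\<And>v. c v < 2" "\<And>u v. {u, v} \<in> edges G \<Longrightarrow> c u \<noteq> c v"
    using bipartite_two_coloring[OF assms(2)] by blast
  then have G2: "colorable G 2"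
    unfolding colorable_def by blast
  show ?thesis
  proof
    assume unfrozen: "chi_unfrozen G"
    show "\<not> has_induced_subgraph G (path_graph 3)"
    proof
      assume "has_induced_subgraph G (path_graph 3)"
      then obtain x y z where xyz: "x \<noteq> z" "{x, y} \<in> edges G" "{y, z} \<in> edges G"
        "{x, z} \<notin> edges G"
        using has_induced_P3_iff[OF assms(1)] by blast
      have v: "x \<in> verts G" "y \<in> verts G" "z \<in> verts G"
        using edgeD xyz(2,3) by blast+
      have "3 \<le> chromatic_number (add_edge G {x, z})"
        by (rule chromatic_number_triangle[OF colorable_add_edge_Suc[OF assms(1) G2 xyz(1)],
            of x y z]) (use v xyz in \<open>simp_all add: add_edge_def\<close>)
      moreover have "chromatic_number (add_edge G {x, z}) = chromatic_number G"
        using unfrozen v xyz unfolding chi_unfrozen_def nonedges_def by blast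
      ultimately show False
        using chromatic_number_le[OF G2] by simp
    qed
  next
    assume noP3: "\<not> has_induced_subgraph G (path_graph 3)"
    \<comment> \<open>Otherwise the absence of an induced path makes \<open>x\<close>,
      \<open>y\<close>, \<open>z\<close> a triangle, which two colours cannot colour.\<close>
    have matching: "x = z" if e: "{x, y} \<in> edges G" "{y, z} \<in> edges G" for x y z
    proof (rule ccontr)
      assume "x \<noteq> z"
      then have "{x, z} \<in> edges G"
        using noP3 e has_induced_P3_iff[OF assms(1)] by blast
      then show False
        using c(2)[of x y] c(2)[of y z] c(2)[of x z] e c(1)[of x] c(1)[of y] c(1)[of z]
        by linarith
    qed
    show "chi_unfrozen G"
      unfolding chi_unfrozen_def
    proof
      fix e assume "e \<in> nonedges G"
      then obtain u v where e: "e = {u, v}" and uv: "u \<in> verts G" "v \<in> verts G" "u \<noteq> v"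
        "{u, v} \<notin> edges G"
        unfolding nonedges_def by blast
      have "finite (verts G)"
        using assms(1) by (simp add: simple_graph_def)
      \<comment> \<open>A nonedge has two distinct ends, so the third hypothesis must provide an
        edge, and \<open>G\<close> needs both colours.\<close>
      then have "\<not> card (verts G) \<le> 1"
        using uv by (auto simp: card_le_Suc0_iff_eq)
      then obtain f where f: "f \<in> edges G"
        using assms(3) by blast
      then have "card f = 2"
        using assms(1) by (simp add: simple_graph_def)
      then obtain a b where "f = {a, b}"
        by (auto simp: card_2_iff)
      with f have ab: "{a, b} \<in> edges G" by simp
      have "chromatic_number G = 2"
        using chromatic_number_eq_2[OF G2 ab] edgeD[OF ab] by blast
      moreover have "colorable (add_edge G e) 2"
        unfolding e using assms(2) matching uv(3,4) by (rule colorable_add_edge_matching)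
      then have "chromatic_number (add_edge G e) = 2"
        by (rule chromatic_number_eq_2[of _ u v]) (use e uv in \<open>simp_all add: add_edge_def\<close>)
      ultimately show "chromatic_number (add_edge G e) = chromatic_number G" by simp
    qed
  qed
qed

end
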